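(* If $G$ is a $\mathcal{T}_1$-graph, then the $r$-independence complex $\mathrm{Ind}_r(G)$ is shellable for all integers $r \geq 5$.
   Context: All graphs are finite and simple. A block of a graph is a maximal connected subgraph that remains connected after removal of any single vertex; $G$ is a block graph if every block is a complete graph (a clique). An $n$-clique path $\mathrm{CP}(B_1,\dots,B_n)$ ($n\ge 1$) is a graph consisting of cliques $B_1,\dots,B_n$ arranged linearly, where each consecutive pair $B_i, B_{i+1}$ shares exactly one vertex $x_i$; $x_1,\dots,x_{n-1}$ are its connecting vertices. A connected graph $H$ is a $\mathcal{T}_1$-graph if it is a block graph and contains a clique-path subgraph $P = \mathrm{CP}(B_1,\dots,B_n)$, $n \ge 1$, of maximum length, with connecting vertices $x_i \in B_i\cap B_{i+1}$ ($1\le i\le n-1$), such that every clique (block) $K$ of $H$ not belonging to $P$ satisfies $V(K)\cap V(P) = \{x_i\}$ for some $1 \le i \le n-1$. A graph is a $\mathcal{T}_1$-graph if each of its connected components is. For $r \geq 1$, a subset $A \subseteq V(G)$ is $r$-independent if every connected component of $G[A]$ has at most $r$ vertices; $\mathrm{Ind}_r(G)$ is the simplicial complex on $V(G)$ of all $r$-independent subsets. A (not necessarily pure) simplicial complex is shellable if its facets can be ordered $F_1,\dots,F_t$ so that for each $k>1$, $\langle F_k\rangle \cap \langle F_1,\dots,F_{k-1}\rangle$ is pure of dimension $\dim F_k-1$ ($\langle\mathcal F\rangle$ = complex generated by $\mathcal F$). *)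

theory Defs
  imports "Graph_Theory.Kuratowski"
begin

text \<open>
  Finite simple graphs are the symmetric, loop-free, finite digraphs without parallel arcs
  of \<^locale>\<open>graph\<close>: an undirected edge is a pair of opposite arcs.  In such a digraph the
  strongly connected components \<^const>\<open>pre_digraph.sccs\<close> are the connected components.
\<close>

section \<open>Block graphs and clique paths\<close>

text \<open>
  The one-vertex graph counts as non-separable (the graph without vertices is not
  \<^const>\<open>connected\<close> in the library), so that an isolated vertex is a block.
\<close>

definition nonseparable :: "('a,'b) pre_digraph \<Rightarrow> bool" where
  "nonseparable H \<longleftrightarrow> connected H \<and>
     (\<forall>v\<in>verts H. verts H \<noteq> {v} \<longrightarrow> connected (pre_digraph.del_vert H v))"

definition blocks :: "('a,'b) pre_digraph \<Rightarrow> ('a,'b) pre_digraph set" where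
  "blocks G = {B. pre_digraph.max_subgraph G (\<lambda>H. graph H \<and> nonseparable H) B}"

definition is_clique :: "('a,'b) pre_digraph \<Rightarrow> bool" where
  "is_clique K \<longleftrightarrow> verts K \<noteq> {} \<and> complete_digraph (card (verts K)) K"

definition block_graph :: "('a,'b) pre_digraph \<Rightarrow> bool" where
  "block_graph G \<longleftrightarrow> graph G \<and> (\<forall>B\<in>blocks G. is_clique B)"

text \<open>
  \<open>clique_path P Bs\<close>: the graph \<open>P\<close> is \<open>CP(B\<^sub>1,\<dots>,B\<^sub>n)\<close> for \<open>Bs = [B\<^sub>1,\<dots>,B\<^sub>n]\<close>, with list positions
  starting at 0.  That the cliques are arranged linearly means that non-consecutive ones are
  disjoint, and that no clique is just the vertex it shares with its neighbour; a
  one-vertex clique is possible only as a path of length 1.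
\<close>

definition clique_path :: "('a,'b) pre_digraph \<Rightarrow> ('a,'b) pre_digraph list \<Rightarrow> bool" where
  "clique_path P Bs \<longleftrightarrow>
     graph P \<and> Bs \<noteq> [] \<and>
     (\<forall>B\<in>set Bs. is_clique B \<and> subgraph B P) \<and>
     verts P = (\<Union>B\<in>set Bs. verts B) \<and>
     arcs P = (\<Union>B\<in>set Bs. arcs B) \<and>
     (length Bs \<ge> 2 \<longrightarrow> (\<forall>B\<in>set Bs. card (verts B) \<ge> 2)) \<and>
     (\<forall>i. i + 1 < length Bs \<longrightarrow> (\<exists>x. verts (Bs ! i) \<inter> verts (Bs ! (i + 1)) = {x})) \<and>
     (\<forall>i j. i + 1 < j \<and> j < length Bs \<longrightarrow> verts (Bs ! i) \<inter> verts (Bs ! j) = {})"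

definition connecting_vertices :: "('a,'b) pre_digraph list \<Rightarrow> 'a set" where
  "connecting_vertices Bs =
     {x. \<exists>i. i + 1 < length Bs \<and> verts (Bs ! i) \<inter> verts (Bs ! (i + 1)) = {x}}"

section \<open>\<open>\<T>\<^sub>1\<close>-graphs\<close>

text \<open>
  The cliques of a clique-path subgraph are whole blocks of the ambient graph.
  With arbitrary complete subgraphs, the complete graph on 4 vertices would contain
  a clique path of three single edges.
\<close>

definition clique_path_in ::
  "('a,'b) pre_digraph \<Rightarrow> ('a,'b) pre_digraph \<Rightarrow> ('a,'b) pre_digraph list \<Rightarrow> bool" where
  "clique_path_in H P Bs \<longleftrightarrow> subgraph P H \<and> clique_path P Bs \<and> set Bs \<subseteq> blocks H"

definition connected_T1_graph :: "('a,'b) pre_digraph \<Rightarrow> bool" where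
  "connected_T1_graph H \<longleftrightarrow>
     connected H \<and> block_graph H \<and>
     (\<exists>P Bs. clique_path_in H P Bs \<and>
        (\<forall>P' Bs'. clique_path_in H P' Bs' \<longrightarrow> length Bs' \<le> length Bs) \<and>
        (\<forall>K\<in>blocks H - set Bs. \<exists>x\<in>connecting_vertices Bs. verts K \<inter> verts P = {x}))"

definition T1_graph :: "('a,'b) pre_digraph \<Rightarrow> bool" where
  "T1_graph G \<longleftrightarrow> graph G \<and> (\<forall>C\<in>pre_digraph.sccs G. connected_T1_graph C)"

section \<open>Shellable complexes and \<open>r\<close>-independence complexes\<close>

text \<open>
  An abstract simplicial complex is given by its set of faces, including the empty face,
  which has dimension \<open>-1\<close>.
\<close>

definition simplicial_complex :: "'a set set \<Rightarrow> bool" where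
  "simplicial_complex \<Delta> \<longleftrightarrow>
     {} \<in> \<Delta> \<and> (\<forall>\<sigma>\<in>\<Delta>. finite \<sigma> \<and> (\<forall>\<tau>. \<tau> \<subseteq> \<sigma> \<longrightarrow> \<tau> \<in> \<Delta>))"

definition facets :: "'a set set \<Rightarrow> 'a set set" where
  "facets \<Delta> = {F\<in>\<Delta>. \<forall>\<sigma>\<in>\<Delta>. F \<subseteq> \<sigma> \<longrightarrow> \<sigma> = F}"

definition face_dim :: "'a set \<Rightarrow> int" where
  "face_dim \<sigma> = int (card \<sigma>) - 1"

definition pure_of_dim :: "'a set set \<Rightarrow> int \<Rightarrow> bool" where
  "pure_of_dim \<Delta> d \<longleftrightarrow> \<Delta> \<noteq> {} \<and> (\<forall>F\<in>facets \<Delta>. face_dim F = d)"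

definition generated_complex :: "'a set set \<Rightarrow> 'a set set" where
  "generated_complex \<F> = {\<sigma>. \<exists>F\<in>\<F>. \<sigma> \<subseteq> F}"

definition shellable :: "'a set set \<Rightarrow> bool" where
  "shellable \<Delta> \<longleftrightarrow> simplicial_complex \<Delta> \<and>
     (\<exists>Fs. distinct Fs \<and> set Fs = facets \<Delta> \<and>
       (\<forall>k. 0 < k \<and> k < length Fs \<longrightarrow>
          pure_of_dim (generated_complex {Fs ! k} \<inter> generated_complex (set (take k Fs)))
            (face_dim (Fs ! k) - 1)))"

definition r_independent :: "('a,'b) pre_digraph \<Rightarrow> nat \<Rightarrow> 'a set \<Rightarrow> bool" where
  "r_independent G r A \<longleftrightarrow>
     A \<subseteq> verts G \<and> (\<forall>C\<in>pre_digraph.sccs (G \<restriction> A). card (verts C) \<le> r)"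

definition Ind :: "nat \<Rightarrow> ('a,'b) pre_digraph \<Rightarrow> 'a set set" where
  "Ind r G = {A. r_independent G r A}"

end

theory Submission
  imports Defs
begin

text \<open>
  The minimal non-faces of \<open>Ind\<^sub>r(G)\<close> are the connected vertex sets of size \<open>r + 1\<close>.  It turns
  out that this clutter is chordal in Woodroofe's sense: every minor (contract \<open>C\<close>, delete \<open>D\<close>) has
  a simplicial vertex.  A vertex of \<open>G\<close> that is not connecting lies in a single block, so its
  neighbours form a clique; removing it from the union of two distinct connected
  \<open>(r + 1)\<close>-sets therefore leaves a connected set of size at least \<open>r + 1\<close>.  Once all these vertices
  are used up, only connecting vertices of the clique paths remain.  A connected set meets
  a path in an interval, and two intervals with the same left end are comparable.

  A simplicial vertex \<open>v\<close> gives a shelling: first come the facets containing \<open>v\<close>; the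
  other facets fall into disjoint classes, one for each minimal edge \<open>m \<ni> v\<close> with
  \<open>m - v \<subseteq> F\<close>, and exchanging any element of \<open>m - v\<close> for \<open>v\<close> leads back to a face containing \<open>v\<close>.
\<close>

section \<open>Shellability of chordal clutters\<close>

definition independent_in :: "'a set set \<Rightarrow> 'a set \<Rightarrow> bool" where
  "independent_in E A \<longleftrightarrow> (\<forall>e\<in>E. \<not> e \<subseteq> A)"

text \<open>
  For disjoint \<open>C\<close> and \<open>D\<close> these are the facets of the minor of \<open>E\<close> in which \<open>C\<close> is contracted and
  \<open>D\<close> deleted, each enlarged by \<open>C\<close>; so the facets of minors need no translation.
\<close>

definition max_independent :: "'a set \<Rightarrow> 'a set set \<Rightarrow> 'a set \<Rightarrow> 'a set \<Rightarrow> 'a set set" where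
  "max_independent V E C D =
     {F. C \<subseteq> F \<and> F \<subseteq> V - D \<and> independent_in E F \<and>
         (\<forall>x\<in>V - D - F. \<not> independent_in E (insert x F))}"

text \<open>Exchange form of the shelling condition: \<open>F \<inter> F'\<close> lies in the
  codimension-one face \<open>F - {z}\<close>, which itself lies in a member of \<open>\<P>\<close>.
  It is vacuous for empty \<open>\<P>\<close>, as fits a first facet.\<close>

definition shelling_step :: "'a set set \<Rightarrow> 'a set \<Rightarrow> bool" where
  "shelling_step \<P> F \<longleftrightarrow> (\<forall>F'\<in>\<P>. \<exists>z\<in>F - F'. \<exists>F''\<in>\<P>. F - {z} \<subseteq> F'')"

text \<open>The argument \<open>\<P>\<close> accumulates the sets placed so far, so that shellings
  of separate classes can be concatenated.\<close>

fun shelling_after :: "'a set set \<Rightarrow> 'a set list \<Rightarrow> bool" where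
  "shelling_after \<P> [] \<longleftrightarrow> True"
| "shelling_after \<P> (F # Fs) \<longleftrightarrow> shelling_step \<P> F \<and> shelling_after (insert F \<P>) Fs"

lemma shelling_after_append:
  "shelling_after \<P> (xs @ ys) \<longleftrightarrow> shelling_after \<P> xs \<and> shelling_after (\<P> \<union> set xs) ys"
  by (induction xs arbitrary: \<P>) auto

lemma shelling_after_nth:
  assumes "shelling_after \<P> Fs" "k < length Fs"
  shows "shelling_step (\<P> \<union> set (take k Fs)) (Fs ! k)"
  using assms
proof (induction Fs arbitrary: \<P> k)
  case (Cons F Fs)
  show ?case
  proof (cases k)
    case (Suc n)
    then show ?thesis using Cons.IH[of "insert F \<P>" n] Cons.prems by simp
  qed (use Cons.prems in simp)
qed simp

text \<open>Predecessors from the list itself or from \<open>\<Q>\<close> keep their witnesses;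
  those from \<open>\<P>\<close> are served by the second assumption. This appends the shelling of
  one class to everything placed before it.\<close>

lemma shelling_after_union:
  assumes "shelling_after \<Q> Fs"
    and "\<And>F F'. F \<in> set Fs \<Longrightarrow> F' \<in> \<P> \<Longrightarrow> \<exists>z\<in>F - F'. \<exists>F''\<in>\<P>. F - {z} \<subseteq> F''"
  shows "shelling_after (\<P> \<union> \<Q>) Fs"
  using assms
proof (induction Fs arbitrary: \<Q>)
  case (Cons F Fs)
  have "shelling_step (\<P> \<union> \<Q>) F"
    unfolding shelling_step_def
  proof
    fix F' assume "F' \<in> \<P> \<union> \<Q>"
    then consider "F' \<in> \<P>" | "F' \<in> \<Q>" by blast
    then show "\<exists>z\<in>F - F'. \<exists>F''\<in>\<P> \<union> \<Q>. F - {z} \<subseteq> F''"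
    proof cases
      case 1
      from Cons.prems(2)[OF _ this, of F] obtain z F'' where "z \<in> F - F'" "F'' \<in> \<P>" "F - {z} \<subseteq> F''" by auto
      then show ?thesis by blast
    next
      case 2
      with Cons.prems(1) obtain z F'' where "z \<in> F - F'" "F'' \<in> \<Q>" "F - {z} \<subseteq> F''"
        unfolding shelling_after.simps shelling_step_def by meson
      then show ?thesis by blast
    qed
  qed
  moreover have "shelling_after (\<P> \<union> insert F \<Q>) Fs"
    by (rule Cons.IH) (use Cons.prems in auto)
  ultimately show ?case by simp
qed simp

section \<open>Independent sets and minimal traces in minors\<close>

lemma independent_in_subset: "independent_in E A \<Longrightarrow> B \<subseteq> A \<Longrightarrow> independent_in E B"
  unfolding independent_in_def by blast

lemma extend_to_max_independent:
  assumes "finite V" "independent_in E A" "C \<subseteq> A" "A \<subseteq> V - D"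
  obtains F where "F \<in> max_independent V E C D" "A \<subseteq> F"
proof -
  let ?\<A> = "{B. B \<subseteq> V - D \<and> independent_in E B}"
  have "finite ?\<A>" by (rule finite_subset[of _ "Pow V"]) (use assms in auto)
  moreover have "A \<in> ?\<A>" using assms by auto
  ultimately obtain F where F: "F \<in> ?\<A>" "A \<subseteq> F" "\<And>B. B \<in> ?\<A> \<Longrightarrow> F \<subseteq> B \<Longrightarrow> B = F"
    using finite_has_maximal2[of ?\<A> A] by (metis (no_types, lifting))
  have "\<not> independent_in E (insert x F)" if "x \<in> V - D - F" for x
    using F(1) F(3)[of "insert x F"] that by blast
  with F(1,2) assms(3) have "F \<in> max_independent V E C D" unfolding max_independent_def by blast
  with F(2) that show thesis by blast
qed

text \<open>
  Woodroofe's simplicial vertices for the minors with \<open>C \<union> D = Q\<close>, independently of how \<open>Q\<close>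
  is split: comparable traces on the complement of \<open>Q\<close> cannot both be minimal unless they agree.
\<close>

definition simplicial_for :: "'a set set \<Rightarrow> 'a set \<Rightarrow> 'a \<Rightarrow> bool" where
  "simplicial_for E Q v \<longleftrightarrow>
     (\<forall>e1\<in>E. \<forall>e2\<in>E. v \<in> e1 \<longrightarrow> v \<in> e2 \<longrightarrow>
        e1 - Q \<subseteq> e2 \<or> e2 - Q \<subseteq> e1 \<or> (\<exists>e3\<in>E. e3 \<subseteq> e1 \<union> e2 - {v}))"

definition traces_at :: "'a set set \<Rightarrow> 'a set \<Rightarrow> 'a set \<Rightarrow> 'a \<Rightarrow> 'a set set" where
  "traces_at E C D v = {e - C | e. e \<in> E \<and> v \<in> e \<and> e \<inter> D = {}}"

text \<open>Minimality is only among traces through \<open>v\<close>, so a member \<open>m\<close>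
  may contain the trace of an edge that avoids \<open>v\<close> and \<open>D\<close>. In that case
  no independent set contains \<open>C \<union> (m - {v})\<close>, and the class of facets assigned
  to \<open>m\<close> is empty.\<close>

definition min_traces_at :: "'a set set \<Rightarrow> 'a set \<Rightarrow> 'a set \<Rightarrow> 'a \<Rightarrow> 'a set set" where
  "min_traces_at E C D v = {m \<in> traces_at E C D v. \<forall>m'\<in>traces_at E C D v. m' \<subseteq> m \<longrightarrow> m' = m}"

text \<open>An edge \<open>e3\<close> inside \<open>e1 \<union> e2 - {v}\<close> would lie in the
  independent set \<open>F\<close>. Hence simpliciality makes the two traces comparable, and
  minimality makes them equal. So a facet avoiding \<open>v\<close> belongs to one class
  only.\<close>

lemma min_trace_unique:
  assumes "simplicial_for E (C \<union> D) v" "C \<inter> D = {}"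
    and "m1 \<in> min_traces_at E C D v" "m2 \<in> min_traces_at E C D v"
    and "independent_in E F" "C \<subseteq> F" "m1 - {v} \<subseteq> F" "m2 - {v} \<subseteq> F"
  shows "m1 = m2"
proof -
  from assms(3) obtain e1 where e1: "e1 \<in> E" "v \<in> e1" "e1 \<inter> D = {}" "m1 = e1 - C"
    unfolding min_traces_at_def traces_at_def by blast
  from assms(4) obtain e2 where e2: "e2 \<in> E" "v \<in> e2" "e2 \<inter> D = {}" "m2 = e2 - C"
    unfolding min_traces_at_def traces_at_def by blast
  have "\<not> (\<exists>e3\<in>E. e3 \<subseteq> e1 \<union> e2 - {v})"
  proof (safe)
    fix e3 assume e3: "e3 \<in> E" "e3 \<subseteq> e1 \<union> e2 - {v}"
    have "e1 - {v} \<subseteq> F" "e2 - {v} \<subseteq> F" using assms(6-8) e1(4) e2(4) by auto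
    with e3(2) have "e3 \<subseteq> F" by blast
    with assms(5) e3(1) show False unfolding independent_in_def by blast
  qed
  with assms(1) e1 e2 have "e1 - (C \<union> D) \<subseteq> e2 \<or> e2 - (C \<union> D) \<subseteq> e1"
    unfolding simplicial_for_def by blast
  then have "m1 \<subseteq> m2 \<or> m2 \<subseteq> m1" using e1 e2 by blast
  moreover have "m1 \<in> traces_at E C D v" "m2 \<in> traces_at E C D v"
    "m1 \<subseteq> m2 \<Longrightarrow> m1 = m2" "m2 \<subseteq> m1 \<Longrightarrow> m2 = m1"
    using assms(3,4) unfolding min_traces_at_def by auto
  ultimately show ?thesis by metis
qed

text \<open>Some edge inside \<open>insert v A\<close> must use \<open>v\<close>. A minimal trace
  within this finite set is minimal among all traces, since any smaller trace lies in the same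
  set.\<close>

lemma min_trace_exists:
  assumes "finite A" "v \<notin> A" "A \<inter> D = {}" "v \<notin> D"
    and "independent_in E A" "\<not> independent_in E (insert v A)" 
  obtains m where "m \<in> min_traces_at E C D v" "m - {v} \<subseteq> A"
proof -
  obtain e where e: "e \<in> E" "e \<subseteq> insert v A" "v \<in> e"
    using assms(5,6) unfolding independent_in_def by blast
  let ?T = "{m \<in> traces_at E C D v. m \<subseteq> insert v A}"
  have "finite ?T" by (rule finite_subset[of _ "Pow (insert v A)"]) (use assms in auto)
  moreover have "e - C \<in> ?T" using e assms unfolding traces_at_def by blast
  ultimately have "\<exists>m\<in>?T. m \<subseteq> e - C \<and> (\<forall>m'\<in>?T. m' \<subseteq> m \<longrightarrow> m = m')"
    by (rule finite_has_minimal2)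
  then obtain m where m: "m \<in> ?T" "\<And>m'. m' \<in> ?T \<Longrightarrow> m' \<subseteq> m \<Longrightarrow> m' = m"
    by (elim bexE conjE) (rule that, assumption, metis)
  have "m \<in> min_traces_at E C D v"
    unfolding min_traces_at_def
  proof (intro CollectI conjI ballI impI)
    show "m \<in> traces_at E C D v" using m(1) by blast
    fix m' assume "m' \<in> traces_at E C D v" "m' \<subseteq> m"
    moreover from \<open>m' \<subseteq> m\<close> m(1) have "m' \<subseteq> insert v A" by blast
    ultimately show "m' = m" using m(2) by blast
  qed
  with m(1) that show thesis by blast
qed

text \<open>Stated for all minors so that induction on the number of vertices outside
  \<open>C \<union> D\<close> applies. The facets containing \<open>v\<close> come from the minor
  with \<open>v\<close> contracted; the class of a minimal trace \<open>m\<close> comes from the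
  minor with \<open>m - {v}\<close> contracted and \<open>v\<close> deleted.\<close>

lemma shelling_exists:
  fixes V :: "'a set"
  assumes fin: "finite V" and EV: "\<And>e. e \<in> E \<Longrightarrow> e \<subseteq> V"
    and simp: "\<And>Q. Q \<subset> V \<Longrightarrow> \<exists>v\<in>V - Q. simplicial_for E Q v"
    and "C \<subseteq> V" "D \<subseteq> V" "C \<inter> D = {}"
  shows "\<exists>Fs. distinct Fs \<and> set Fs = max_independent V E C D \<and> shelling_after {} Fs"
  using assms(4-6)
proof (induction "card (V - (C \<union> D))" arbitrary: C D rule: less_induct)
  case less
  show ?case
  proof (cases "C \<union> D = V")
    case True
    with less.prems have "V - D = C" by blast
    then have "max_independent V E C D = (if independent_in E C then {C} else {})"
      unfolding max_independent_def by auto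
    then show ?thesis
      by (intro exI[of _ "if independent_in E C then [C] else []"]) (auto simp: shelling_step_def)
  next
    case False
    with less.prems have "C \<union> D \<subset> V" by blast
    from simp[OF this] obtain v where v: "v \<in> V" "v \<notin> C" "v \<notin> D"
      and simpv: "simplicial_for E (C \<union> D) v" by auto
    let ?Star = "max_independent V E (insert v C) D"
    let ?M = "min_traces_at E C D v"
    let ?Bl = "\<lambda>m. max_independent V E (C \<union> (m - {v})) (insert v D)"
    have smaller: "card (V - (C' \<union> D')) < card (V - (C \<union> D))"
      if "C \<subseteq> C'" "D \<subseteq> D'" "v \<in> C' \<union> D'" for C' D'
      by (rule psubset_card_mono) (use fin that v in auto)
    have "\<exists>Fs. distinct Fs \<and> set Fs = ?Star \<and> shelling_after {} Fs"
      by (rule less.hyps[OF smaller]) (use less.prems v in auto)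
    then obtain S where S: "distinct S" "set S = ?Star" "shelling_after {} S" by blast
    have MV: "v \<in> m" "m \<subseteq> V" "m \<inter> D = {}" "m \<inter> C = {}" "\<exists>e\<in>E. e \<subseteq> C \<union> m" if "m \<in> ?M" for m
    proof -
      from that obtain e where "e \<in> E" "v \<in> e" "e \<inter> D = {}" "m = e - C"
        unfolding min_traces_at_def traces_at_def by blast
      then show "v \<in> m" "m \<subseteq> V" "m \<inter> D = {}" "m \<inter> C = {}" "\<exists>e\<in>E. e \<subseteq> C \<union> m"
        using v EV[of e] by blast+
    qed
    have blocks: "\<exists>Fs. distinct Fs \<and> set Fs = ?Bl m \<and> shelling_after {} Fs" if "m \<in> ?M" for m
      by (rule less.hyps[OF smaller]) (use less.prems v MV[OF that] in auto)
    \<comment> \<open>Exchange \<open>z\<close> for \<open>v\<close>. If the result were dependent,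
      some minimal trace \<open>m'\<close> would satisfy
      \<open>m' - {v} \<subseteq> F - {z}\<close>; uniqueness gives \<open>m' = m\<close>, although
      \<open>z\<close> lies in \<open>m\<close>.\<close>
    have exchange: "\<exists>z\<in>F - F'. \<exists>F''\<in>?Star. F - {z} \<subseteq> F''"
      if m: "m \<in> ?M" and F: "F \<in> ?Bl m" and F': "\<not> m - {v} \<subseteq> F'" for m F F'
    proof -
      from F have F1: "C \<union> (m - {v}) \<subseteq> F" "F \<subseteq> V - insert v D" "independent_in E F"
        unfolding max_independent_def by auto
      from F' F1 obtain z where z: "z \<in> m" "z \<noteq> v" "z \<in> F" "z \<notin> F'" by blast
      have "independent_in E (insert v (F - {z}))"
      proof (rule ccontr)
        assume neg: "\<not> independent_in E (insert v (F - {z}))"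
        have "finite (F - {z})" using F1(2) fin by (meson finite_Diff finite_subset)
        moreover have "independent_in E (F - {z})" by (rule independent_in_subset[OF F1(3)]) auto
        ultimately obtain m' where m': "m' \<in> ?M" "m' - {v} \<subseteq> F - {z}"
          using min_trace_exists[of "F - {z}" v D E C] neg F1(2) v by blast
        have "m' = m"
          by (rule min_trace_unique[OF simpv less.prems(3) m'(1) m F1(3)]) (use F1 m' in auto)
        with m'(2) z show False by blast
      qed
      moreover have "insert v C \<subseteq> insert v (F - {z})" using F1(1) z(1) MV(4)[OF m] by blast
      moreover have "insert v (F - {z}) \<subseteq> V - D" using F1(2) v by blast
      ultimately obtain F'' where "F'' \<in> ?Star" "insert v (F - {z}) \<subseteq> F''"
        using extend_to_max_independent[OF fin] by metis
      with z show ?thesis by blast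
    qed
    \<comment> \<open>A facet in the star already contains \<open>v\<close> and \<open>C\<close>, so
      \<open>m - {v}\<close> would complete an edge in it.\<close>
    have star_avoid: "\<not> m - {v} \<subseteq> F'" if "m \<in> ?M" "F' \<in> ?Star" for m F'
    proof
      assume sub: "m - {v} \<subseteq> F'"
      from MV(5)[OF that(1)] obtain e where e: "e \<in> E" "e \<subseteq> C \<union> m" by blast
      have "insert v C \<subseteq> F'" "independent_in E F'"
        using that(2) unfolding max_independent_def by auto
      with sub e show False unfolding independent_in_def by blast
    qed
    have block_avoid: "\<not> m - {v} \<subseteq> F'" if "m \<in> ?M" "m' \<in> ?M" "m \<noteq> m'" "F' \<in> ?Bl m'" for m m' F'
    proof
      assume "m - {v} \<subseteq> F'"
      moreover have "independent_in E F'" "C \<subseteq> F'" "m' - {v} \<subseteq> F'"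
        using that(4) unfolding max_independent_def by auto
      ultimately have "m = m'" using min_trace_unique[OF simpv less.prems(3) that(1,2)] by blast
      with that(3) show False ..
    qed
    have "?M \<subseteq> Pow V" using MV(2) by blast
    then have "finite ?M" using fin finite_subset by blast
    \<comment> \<open>The classes may be appended in any order, because \<open>exchange\<close>
      always leads back to the star, which is placed first.\<close>
    have "\<exists>Fs. distinct Fs \<and> set Fs = ?Star \<union> (\<Union>m\<in>N. ?Bl m) \<and> shelling_after {} Fs"
      if "N \<subseteq> ?M" for N
      using finite_subset[OF that \<open>finite ?M\<close>] that
    proof (induction N rule: finite_induct)
      case empty
      then show ?case using S by auto
    next
      case (insert m N)
      then have mM: "m \<in> ?M" and NM: "N \<subseteq> ?M" by auto
      from insert.IH[OF NM] obtain Fs where Fs: "distinct Fs" "shelling_after {} Fs"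
        "set Fs = ?Star \<union> (\<Union>m\<in>N. ?Bl m)" by blast
      from blocks[OF mM] obtain Gs where Gs: "distinct Gs" "set Gs = ?Bl m" "shelling_after {} Gs"
        by blast
      have avoid: "\<not> m - {v} \<subseteq> F'" if "F' \<in> set Fs" for F'
        using that Fs(3) star_avoid[OF mM] block_avoid[OF mM] NM insert.hyps(2) by blast
      have "m - {v} \<subseteq> F" if "F \<in> set Gs" for F
        using that Gs(2) unfolding max_independent_def by blast
      with avoid have "distinct (Fs @ Gs)" using Fs(1) Gs(1) by auto
      moreover have "shelling_after (set Fs \<union> {}) Gs"
      proof (rule shelling_after_union[OF Gs(3)])
        fix F F' assume "F \<in> set Gs" "F' \<in> set Fs"
        then have "\<exists>z\<in>F - F'. \<exists>F''\<in>?Star. F - {z} \<subseteq> F''"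
          using exchange[OF mM _ avoid] Gs(2) by blast
        then show "\<exists>z\<in>F - F'. \<exists>F''\<in>set Fs. F - {z} \<subseteq> F''" using Fs(3) by blast
      qed
      then have "shelling_after {} (Fs @ Gs)" using Fs(2) by (simp add: shelling_after_append)
      moreover have "set (Fs @ Gs) = ?Star \<union> (\<Union>m\<in>insert m N. ?Bl m)" using Fs(3) Gs(2) by auto
      ultimately show ?case by blast
    qed
    then have "\<exists>Fs. distinct Fs \<and> set Fs = ?Star \<union> (\<Union>m\<in>?M. ?Bl m) \<and> shelling_after {} Fs" by blast
    moreover have "max_independent V E C D = ?Star \<union> (\<Union>m\<in>?M. ?Bl m)"
    proof (intro equalityI subsetI)
      fix F assume F: "F \<in> max_independent V E C D"
      then have F1: "C \<subseteq> F" "F \<subseteq> V - D" "independent_in E F"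
        "\<forall>x\<in>V - D - F. \<not> independent_in E (insert x F)" unfolding max_independent_def by auto
      show "F \<in> ?Star \<union> (\<Union>m\<in>?M. ?Bl m)"
      proof (cases "v \<in> F")
        case True
        with F show ?thesis unfolding max_independent_def by blast
      next
        case False
        have "finite F" using F1(2) fin by (meson finite_Diff finite_subset)
        then obtain m where "m \<in> ?M" "m - {v} \<subseteq> F"
          using min_trace_exists[of F v D E C] F1 False v by blast
        then show ?thesis using F1 False unfolding max_independent_def by blast
      qed
    next
      fix F assume "F \<in> ?Star \<union> (\<Union>m\<in>?M. ?Bl m)"
      then consider "F \<in> ?Star" | m where "m \<in> ?M" "F \<in> ?Bl m" by blast
      then show "F \<in> max_independent V E C D"
      proof cases
        case 1
        then show ?thesis unfolding max_independent_def by blast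
      next
        case 2
        \<comment> \<open>Members of the class are maximal only with \<open>v\<close> deleted;
          adding \<open>v\<close> completes an edge inside \<open>C \<union> m\<close>, so they are
          maximal with \<open>v\<close> present as well.\<close>
        have "\<not> independent_in E (insert v F)"
        proof -
          from MV(5)[OF 2(1)] obtain e where e: "e \<in> E" "e \<subseteq> C \<union> m" by blast
          moreover have "C \<union> (m - {v}) \<subseteq> F" using 2(2) unfolding max_independent_def by auto
          ultimately have "e \<subseteq> insert v F" by blast
          with e(1) show ?thesis unfolding independent_in_def by blast
        qed
        with 2(2) show ?thesis unfolding max_independent_def by blast
      qed
    qed
    ultimately show ?thesis by metis
  qed
qed

text \<open>The facets are the maximal independent sets with nothing contracted or deleted. A facet
  of the intersection with earlier facets lies in some \<open>F - {z}\<close> that also belongs to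
  this intersection, hence equals it; this is the required purity.\<close>

lemma shellable_independence_complex:
  fixes V :: "'a set"
  assumes fin: "finite V" and EV: "\<And>e. e \<in> E \<Longrightarrow> e \<subseteq> V" and ne: "{} \<notin> E"
    and simp: "\<And>Q. Q \<subset> V \<Longrightarrow> \<exists>v\<in>V - Q. simplicial_for E Q v"
  shows "shellable {A. A \<subseteq> V \<and> independent_in E A}" (is "shellable ?\<Delta>")
proof -
  have complex: "simplicial_complex ?\<Delta>"
    unfolding simplicial_complex_def
    using fin ne by (auto simp: independent_in_def intro: finite_subset)
  have fac: "facets ?\<Delta> = max_independent V E {} {}"
  proof (intro equalityI subsetI)
    fix F assume F: "F \<in> facets ?\<Delta>"
    then have "\<not> independent_in E (insert x F)" if "x \<in> V - F" for x
      using that unfolding facets_def by blast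
    with F show "F \<in> max_independent V E {} {}"
      unfolding facets_def max_independent_def by auto
  next
    fix F assume F: "F \<in> max_independent V E {} {}"
    have "\<sigma> = F" if "\<sigma> \<subseteq> V" "independent_in E \<sigma>" "F \<subseteq> \<sigma>" for \<sigma>
    proof (rule ccontr)
      assume "\<sigma> \<noteq> F"
      with that obtain x where "x \<in> \<sigma>" "x \<notin> F" by blast
      moreover have "independent_in E (insert x F)"
        by (rule independent_in_subset[OF that(2)]) (use that \<open>x \<in> \<sigma>\<close> in auto)
      ultimately show False using F that unfolding max_independent_def by blast
    qed
    with F show "F \<in> facets ?\<Delta>" unfolding facets_def max_independent_def by auto
  qed
  from shelling_exists[OF fin EV simp, of "{}" "{}"]
  obtain Fs where Fs: "distinct Fs" "set Fs = facets ?\<Delta>" "shelling_after {} Fs"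
    unfolding fac by auto
  have "pure_of_dim (generated_complex {Fs ! k} \<inter> generated_complex (set (take k Fs)))
      (face_dim (Fs ! k) - 1)" (is "pure_of_dim ?I _") if k: "0 < k" "k < length Fs" for k
  proof -
    let ?F = "Fs ! k"
    have step: "shelling_step (set (take k Fs)) ?F"
      using shelling_after_nth[OF Fs(3) k(2)] by simp
    have finF: "finite ?F"
      using nth_mem[OF k(2)] Fs(2) fin by (auto simp: facets_def intro: finite_subset)
    have "Fs ! 0 \<in> set (take k Fs)" using k by (auto simp: in_set_conv_nth intro!: exI[of _ 0])
    then have "{} \<in> ?I" unfolding generated_complex_def by auto
    moreover have "face_dim \<sigma> = face_dim ?F - 1" if \<sigma>: "\<sigma> \<in> facets ?I" for \<sigma>
    proof -
      from \<sigma> obtain F' where F': "F' \<in> set (take k Fs)" "\<sigma> \<subseteq> F'" "\<sigma> \<subseteq> ?F"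
        unfolding facets_def generated_complex_def by auto
      from step F'(1) obtain z F'' where z: "z \<in> ?F - F'" "F'' \<in> set (take k Fs)" "?F - {z} \<subseteq> F''"
        unfolding shelling_step_def by meson
      have "?F - {z} \<in> ?I" using z unfolding generated_complex_def by auto
      moreover have "\<sigma> \<subseteq> ?F - {z}" using F' z by auto
      ultimately have "\<sigma> = ?F - {z}" using \<sigma> unfolding facets_def by auto
      moreover have "card ?F > 0" using z(1) finF by (auto simp: card_gt_0_iff)
      ultimately show ?thesis using z(1) finF by (simp add: face_dim_def of_nat_diff)
    qed
    ultimately show ?thesis unfolding pure_of_dim_def by blast
  qed
  with complex Fs show ?thesis unfolding shellable_def by blast
qed

section \<open>Connected vertex sets\<close>

text \<open>For symmetric \<open>R\<close> this is connectedness of the subgraph induced on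
  \<open>S\<close>. Phrased by a relation, it reads the same in \<open>G\<close> and in every
  induced subgraph containing \<open>S\<close>.\<close>

definition connected_on :: "('a \<times> 'a) set \<Rightarrow> 'a set \<Rightarrow> bool" where
  "connected_on R S \<longleftrightarrow> S \<noteq> {} \<and> (\<forall>a\<in>S. \<forall>b\<in>S. (a, b) \<in> rtrancl_on S R)"

text \<open>The graph-theoretic notion (for symmetric \<open>R\<close>, the neighbours form a
  clique), as opposed to the clutter notion \<open>simplicial_for\<close>.\<close>

definition simplicial_vertex :: "('a \<times> 'a) set \<Rightarrow> 'a \<Rightarrow> bool" where
  "simplicial_vertex R v \<longleftrightarrow> (\<forall>u w. (u, v) \<in> R \<longrightarrow> (v, w) \<in> R \<longrightarrow> u \<noteq> w \<longrightarrow> (u, w) \<in> R)"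

section \<open>Paths and operations on connected sets\<close>

lemma connected_on_singleton: "connected_on R {a}"
  by (simp add: connected_on_def)

lemma connected_on_subset_rel:
  assumes "connected_on R S" "R \<inter> S \<times> S \<subseteq> R'"
  shows "connected_on R' S"
proof -
  have "(a, b) \<in> rtrancl_on S R'" if "(a, b) \<in> rtrancl_on S R" for a b
    using that by (induction rule: rtrancl_on_induct) (use assms(2) in \<open>auto intro: rtrancl_on_into_rtrancl_on\<close>)
  with assms(1) show ?thesis unfolding connected_on_def by blast
qed

lemma connected_on_Un:
  assumes "connected_on R S" "connected_on R T" "S \<inter> T \<noteq> {}"
  shows "connected_on R (S \<union> T)"
proof -
  from assms(3) obtain z where z: "z \<in> S" "z \<in> T" by blast
  have mono: "(a, b) \<in> rtrancl_on (S \<union> T) R"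
    if "(a, b) \<in> rtrancl_on S R \<or> (a, b) \<in> rtrancl_on T R" for a b
    using that rtrancl_on_mono[OF order_refl, of S "S \<union> T"] rtrancl_on_mono[OF order_refl, of T "S \<union> T"]
    by blast
  have "(a, z) \<in> rtrancl_on (S \<union> T) R \<and> (z, a) \<in> rtrancl_on (S \<union> T) R" if "a \<in> S \<union> T" for a
    using that assms(1,2) z unfolding connected_on_def by (meson UnE mono)
  then show ?thesis
    using assms(1) unfolding connected_on_def by (meson Un_empty rtrancl_on_trans)
qed

lemma connected_on_insert:
  assumes "sym R" "connected_on R S" "z \<in> S" "(z, w) \<in> R"
  shows "connected_on R (insert w S)"
proof -
  have "(z, w) \<in> rtrancl_on {z, w} R" "(w, z) \<in> rtrancl_on {z, w} R"
    using assms(4) symD[OF assms(1,4)] by (auto intro: rtrancl_on_into_rtrancl_on)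
  then have "connected_on R {z, w}" unfolding connected_on_def by auto
  from connected_on_Un[OF assms(2) this] assms(3) show ?thesis
    by (simp add: insert_absorb insert_commute)
qed

lemma connected_on_path:
  assumes "sym R" "p \<noteq> []" "successively (\<lambda>a b. (a, b) \<in> R) p"
  shows "connected_on R (set p)"
  using assms(2,3)
proof (induction p)
  case (Cons a p)
  show ?case
  proof (cases p)
    case Nil
    then show ?thesis by (simp add: connected_on_singleton)
  next
    case (Cons b q)
    with Cons.prems Cons.IH have "connected_on R (set p)" "(a, b) \<in> R" by auto
    then show ?thesis
      using connected_on_insert[OF assms(1), of "set p" b a] symD[OF assms(1)] Cons by simp
  qed
qed simp

text \<open>When the walk returns to a vertex already on the path, the path is cut back to that
  vertex.\<close>

lemma rtrancl_on_distinct_path: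
  assumes "(a, b) \<in> rtrancl_on S R"
  shows "\<exists>p. p \<noteq> [] \<and> hd p = a \<and> last p = b \<and> distinct p \<and> set p \<subseteq> S \<and>
    successively (\<lambda>a b. (a, b) \<in> R) p"
  using assms
proof (induction rule: rtrancl_on_induct)
  case base
  then show ?case by (intro exI[of _ "[a]"]) simp
next
  case (step y z)
  then obtain p where p: "p \<noteq> []" "hd p = a" "last p = y" "distinct p" "set p \<subseteq> S"
    "successively (\<lambda>a b. (a, b) \<in> R) p" by blast
  show ?case
  proof (cases "z \<in> set p")
    case True
    then obtain q r where "p = q @ z # r" by (meson split_list)
    with p show ?thesis
      by (intro exI[of _ "q @ [z]"]) (auto simp: successively_append_iff hd_append split: if_splits)
  next
    case False
    with p step.hyps show ?thesis
      by (intro exI[of _ "p @ [z]"]) (auto simp: successively_append_iff)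
  qed
qed

text \<open>A walk passing through \<open>v\<close> can take the edge between the vertices before
  and after \<open>v\<close> instead.\<close>

lemma connected_on_remove_simplicial:
  assumes sym: "sym R" and S: "connected_on R S" and v: "simplicial_vertex R v" and ne: "S - {v} \<noteq> {}"
  shows "connected_on R (S - {v})"
proof -
  let ?T = "S - {v}"
  \<comment> \<open>While the walk stands at \<open>v\<close>, the invariant remembers a neighbour
    \<open>u\<close> of \<open>v\<close> reached without \<open>v\<close>; the shortcut starts
    there.\<close>
  have main: "(b \<noteq> v \<longrightarrow> (a, b) \<in> rtrancl_on ?T R) \<and>
      (b = v \<longrightarrow> (\<exists>u\<in>?T. (u, v) \<in> R \<and> (a, u) \<in> rtrancl_on ?T R))"
    if "(a, b) \<in> rtrancl_on S R" "a \<in> ?T" for a b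
    using that
  proof (induction rule: rtrancl_on_induct)
    case base
    then show ?case by auto
  next
    case (step y z)
    show ?case
    proof (cases "y = v")
      case False
      with step have y: "(a, y) \<in> rtrancl_on ?T R" "y \<in> ?T" by auto
      show ?thesis
      proof (intro conjI impI)
        assume "z \<noteq> v"
        then show "(a, z) \<in> rtrancl_on ?T R" using y step.hyps by (auto intro: rtrancl_on_into_rtrancl_on)
      next
        assume "z = v"
        then show "\<exists>u\<in>?T. (u, v) \<in> R \<and> (a, u) \<in> rtrancl_on ?T R" using y step.hyps by auto
      qed
    next
      case True
      with step obtain u where u: "u \<in> ?T" "(u, v) \<in> R" "(a, u) \<in> rtrancl_on ?T R" by blast
      show ?thesis
      proof (intro conjI impI)
        assume "z \<noteq> v"
        show "(a, z) \<in> rtrancl_on ?T R"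
        proof (cases "u = z")
          case False
          with v u True step.hyps have "(u, z) \<in> R" unfolding simplicial_vertex_def by blast
          with u \<open>z \<noteq> v\<close> step.hyps show ?thesis by (auto intro: rtrancl_on_into_rtrancl_on)
        qed (use u in simp)
      next
        assume "z = v"
        then show "\<exists>u\<in>?T. (u, v) \<in> R \<and> (a, u) \<in> rtrancl_on ?T R" using u by blast
      qed
    qed
  qed
  have "(a, b) \<in> rtrancl_on ?T R" if "a \<in> ?T" "b \<in> ?T" for a b
    using main[of a b] that S unfolding connected_on_def by auto
  with ne show ?thesis unfolding connected_on_def by blast
qed

text \<open>Grow the set from one vertex: as long as it is a proper subset of the connected set
  \<open>S\<close>, some edge inside \<open>S\<close> leaves it.\<close>

lemma connected_on_subset_card:
  assumes sym: "sym R" and S: "connected_on R S" and fin: "finite S" and k: "1 \<le> k" "k \<le> card S"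
  obtains T where "T \<subseteq> S" "connected_on R T" "card T = k"
proof -
  have "\<exists>T\<subseteq>S. connected_on R T \<and> card T = k"
    using k
  proof (induction k rule: dec_induct)
    case base
    from S obtain a where "a \<in> S" unfolding connected_on_def by blast
    then show ?case by (intro exI[of _ "{a}"]) (simp add: connected_on_singleton)
  next
    case (step k)
    then obtain T where T: "T \<subseteq> S" "connected_on R T" "card T = k" by auto
    from step.prems T have "T \<noteq> S" by auto
    with T obtain b where b: "b \<in> S" "b \<notin> T" by blast
    from T obtain a where a: "a \<in> T" unfolding connected_on_def by blast
    have "\<exists>z w. z \<in> T \<and> w \<in> S - T \<and> (z, w) \<in> R"
    proof (rule ccontr)
      assume no: "\<not> ?thesis"
      have "(a, b) \<in> rtrancl_on S R" using S a b T unfolding connected_on_def by blast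
      then have "b \<in> T" by (induction rule: rtrancl_on_induct) (use a no in auto)
      with b show False by simp
    qed
    then obtain z w where zw: "z \<in> T" "w \<in> S - T" "(z, w) \<in> R" by blast
    have "connected_on R (insert w T)" by (rule connected_on_insert[OF sym T(2) zw(1,3)])
    moreover have "card (insert w T) = Suc k"
      using zw(2) T(1,3) fin by (simp add: finite_subset)
    ultimately show ?case using zw(2) T(1) by (intro exI[of _ "insert w T"]) auto
  qed
  with that show thesis by blast
qed

section \<open>Blocks\<close>

lemma arcs_ends_induce: "arcs_ends (G \<restriction> S) = arcs_ends G \<inter> S \<times> S"
  by (auto simp: arcs_ends_conv)

lemma sym_arcs_ends: "graph G \<Longrightarrow> sym (arcs_ends G)"
  using sym_digraph.sym_arcs[of G] unfolding graph_def pseudo_graph_def symmetric_def by blast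

lemma strongly_connected_iff_connected_on:
  "strongly_connected G \<longleftrightarrow> connected_on (arcs_ends G) (verts G)"
  unfolding strongly_connected_def connected_on_def reachable_def by simp

lemma connected_iff_connected_on:
  assumes "sym (arcs_ends G)"
  shows "connected G \<longleftrightarrow> connected_on (arcs_ends G) (verts G)"
proof -
  have "(arcs_ends G)\<^sup>s = arcs_ends G"
    using assms unfolding symcl_def by (auto dest: symD)
  then show ?thesis unfolding connected_conv connected_on_def by simp
qed

lemma connected_on_induce:
  "connected_on (arcs_ends (G \<restriction> S)) T \<longleftrightarrow> connected_on (arcs_ends G) T" if "T \<subseteq> S"
  using connected_on_subset_rel[of "arcs_ends (G \<restriction> S)" T "arcs_ends G"]
    connected_on_subset_rel[of "arcs_ends G" T "arcs_ends (G \<restriction> S)"] that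
  by (auto simp: arcs_ends_induce)

lemma connected_induce_iff:
  assumes "graph G"
  shows "connected (G \<restriction> S) \<longleftrightarrow> connected_on (arcs_ends G) S"
proof -
  have "sym (arcs_ends (G \<restriction> S))"
    using sym_arcs_ends[OF assms] unfolding arcs_ends_induce sym_def by blast
  from connected_iff_connected_on[OF this] show ?thesis by (simp add: connected_on_induce)
qed

lemma strongly_connected_induce_iff:
  "strongly_connected (G \<restriction> S) \<longleftrightarrow> connected_on (arcs_ends G) S"
  by (simp add: strongly_connected_iff_connected_on connected_on_induce)

lemma arcs_ends_graphD:
  assumes "graph G" "(u, v) \<in> arcs_ends G"
  shows "u \<in> verts G" "v \<in> verts G" "u \<noteq> v"
proof -
  interpret graph G by fact
  from assms(2) obtain e where "e \<in> arcs G" "tail G e = u" "head G e = v" by blast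
  then show "u \<in> verts G" "v \<in> verts G" "u \<noteq> v" using no_loops by auto
qed

lemma graph_induced_subgraph:
  assumes "graph G" "induced_subgraph H G"
  shows "graph H"
proof -
  interpret graph G by fact
  from assms(2) have "digraph H" by (rule digraphI_induced)
  moreover from assms(2) have "sym_digraph H" by (rule induced_graph_imp_graph)
  ultimately show ?thesis
    by (simp add: graph_def pseudo_graph_def digraph_def)
qed

text \<open>Among the non-separable subgraphs containing \<open>H\<close>, one with the most
  vertices and arcs together is maximal for inclusion.\<close>

lemma nonseparable_in_block:
  assumes G: "graph G" and H: "subgraph H G" "graph H" "nonseparable H"
  obtains K where "K \<in> blocks G" "subgraph H K"
proof -
  interpret graph G by fact
  let ?P = "\<lambda>K. subgraph K G \<and> graph K \<and> nonseparable K \<and> subgraph H K"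
  let ?f = "\<lambda>K :: ('a, 'b) pre_digraph. card (verts K) + card (arcs K)"
  have fK: "finite (verts K)" "finite (arcs K)" if "subgraph K G" for K
    using that finite_verts finite_arcs unfolding subgraph_def by (meson finite_subset)+
  have "?P H" using H by (auto simp: wf_digraph.subgraph_refl)
  moreover have "\<forall>K. ?P K \<longrightarrow> ?f K < Suc (?f G)"
    by (auto simp: less_Suc_eq_le intro!: add_mono card_mono)
  ultimately obtain K where K: "?P K" "\<And>K'. ?P K' \<Longrightarrow> ?f K' \<le> ?f K"
    using ex_has_greatest_nat[of ?P H ?f "Suc (?f G)"] by (metis (no_types, lifting) less_or_eq_imp_le)
  have "max_subgraph (\<lambda>K. graph K \<and> nonseparable K) K"
    unfolding max_subgraph_def
  proof (intro conjI allI impI notI)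
    fix K' assume K': "K' \<noteq> K \<and> subgraph K K'" "subgraph K' G \<and> graph K' \<and> nonseparable K'"
    then have "?P K'" using K(1) subgraph_trans by blast
    then have le: "?f K' \<le> ?f K" by (rule K(2))
    have sub: "verts K \<subseteq> verts K'" "arcs K \<subseteq> arcs K'" using K' by auto
    have "finite (verts K')" "finite (arcs K')" using K' fK by auto
    moreover from this sub have "card (verts K) \<le> card (verts K')" "card (arcs K) \<le> card (arcs K')"
      by (auto intro: card_mono)
    ultimately have "verts K = verts K'" "arcs K = arcs K'"
      using le sub card_subset_eq[of "verts K'" "verts K"] card_subset_eq[of "arcs K'" "arcs K"]
      by simp_all
    \<comment> \<open>Equality of the records also needs equal end maps, which compatibility of
      subgraphs provides.\<close>
    moreover have "tail K = tail K'" "head K = head K'"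
      using K' by (auto simp: subgraph_def compatible_def)
    ultimately show False using K' by simp
  qed (use K in auto)
  then have "K \<in> blocks G" unfolding blocks_def by simp
  with K(1) that show thesis by blast
qed

text \<open>Deleting a vertex from a cycle leaves a path, so the subgraph induced on the cycle is
  non-separable. A list of two adjacent vertices counts as a cycle, which also covers single
  edges.\<close>

lemma cycle_in_block:
  assumes G: "graph G" and c: "c \<noteq> []" "distinct c" "set c \<subseteq> verts G"
    "successively (\<lambda>a b. (a, b) \<in> arcs_ends G) c" "(last c, hd c) \<in> arcs_ends G"
  obtains K where "K \<in> blocks G" "set c \<subseteq> verts K"
proof -
  interpret graph G by fact
  note sym = sym_arcs_ends[OF G]
  let ?H = "G \<restriction> set c"
  have "connected (pre_digraph.del_vert ?H v)" if v: "v \<in> verts ?H" "verts ?H \<noteq> {v}" for v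
  proof -
    from v obtain xs ys where xy: "c = xs @ v # ys" using split_list[of v c] by auto
    have del: "pre_digraph.del_vert ?H v = G \<restriction> set (ys @ xs)"
      using c(2) xy by (auto simp: pre_digraph.del_vert_def induce_subgraph_def)
    \<comment> \<open>The remaining path starts behind \<open>v\<close> and passes the closing edge
      of the cycle.\<close>
    have "successively (\<lambda>a b. (a, b) \<in> arcs_ends G) (ys @ xs)"
      using c(4,5) xy by (auto simp: successively_append_iff successively_Cons hd_append split: if_splits)
    moreover have "ys @ xs \<noteq> []" using v xy by auto
    ultimately show ?thesis unfolding del connected_induce_iff[OF G]
      by (intro connected_on_path[OF sym])
  qed
  moreover have "connected ?H"
    unfolding connected_induce_iff[OF G] by (intro connected_on_path[OF sym] c)
  ultimately have "nonseparable ?H" unfolding nonseparable_def by blast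
  moreover have ind: "induced_subgraph ?H G" using c(3) by (rule induced_induce)
  ultimately obtain K where "K \<in> blocks G" "subgraph ?H K"
    using nonseparable_in_block[OF G] graph_induced_subgraph[OF G ind] by blast
  moreover from \<open>subgraph ?H K\<close> have "set c \<subseteq> verts K"
    using subgraph_imp_subverts by fastforce
  ultimately show thesis using that by blast
qed

lemma edge_in_block:
  assumes "graph G" "(u, v) \<in> arcs_ends G"
  obtains K where "K \<in> blocks G" "u \<in> verts K" "v \<in> verts K"
  using cycle_in_block[OF assms(1), of "[u, v]"] arcs_ends_graphD[OF assms]
    assms(2) symD[OF sym_arcs_ends[OF assms(1)] assms(2)] by auto

lemma block_graph_adjacent:
  assumes "block_graph G" "K \<in> blocks G" "u \<in> verts K" "v \<in> verts K" "u \<noteq> v"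
  shows "(u, v) \<in> arcs_ends G"
proof -
  have "subgraph K G"
    using assms(2) by (simp add: blocks_def pre_digraph.subgraphI_max_subgraph)
  moreover have "(u, v) \<in> arcs_ends K"
    using assms unfolding block_graph_def is_clique_def complete_digraph_def by auto
  ultimately show ?thesis using arcs_ends_mono by blast
qed

section \<open>The clique path of a connected \<open>\<T>\<^sub>1\<close>-graph\<close>

text \<open>
  Every cycle lies in a block, and a block contains at most two connecting vertices, which are then
  consecutive.  Both claims follow by closing a path to a cycle along the clique path.
\<close>

lemma connected_T1_graph_spine:
  assumes H: "graph H" and T1: "connected_T1_graph H"
  obtains xs where "\<And>v. v \<in> verts H \<Longrightarrow> v \<notin> set xs \<Longrightarrow> simplicial_vertex (arcs_ends H) v"
    and "\<And>S i j k. \<lbrakk>connected_on (arcs_ends H) S; S \<subseteq> verts H; i < j; j < k; k < length xs;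
           xs ! i \<in> S; xs ! k \<in> S\<rbrakk> \<Longrightarrow> xs ! j \<in> S"
proof -
  let ?R = "arcs_ends H"
  note sym = sym_arcs_ends[OF H]
  from T1 obtain P Bs where bg: "block_graph H" and P: "subgraph P H" "clique_path P Bs"
    "set Bs \<subseteq> blocks H"
    and off: "\<And>K. K \<in> blocks H \<Longrightarrow> K \<notin> set Bs \<Longrightarrow>
      \<exists>x\<in>connecting_vertices Bs. verts K \<inter> verts P = {x}"
    unfolding connected_T1_graph_def clique_path_in_def by blast
  define n where "n = length Bs"
  from P(2) have vP: "verts P = (\<Union>B\<in>set Bs. verts B)"
    and "\<forall>i. i + 1 < n \<longrightarrow> (\<exists>x. verts (Bs ! i) \<inter> verts (Bs ! (i + 1)) = {x})"
    and far: "\<And>i j. i + 1 < j \<Longrightarrow> j < n \<Longrightarrow> verts (Bs ! i) \<inter> verts (Bs ! j) = {}"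
    unfolding clique_path_def n_def by blast+
  then obtain x where x: "\<And>i. i + 1 < n \<Longrightarrow> verts (Bs ! i) \<inter> verts (Bs ! (i + 1)) = {x i}"
    by metis
  have conn: "connecting_vertices Bs = x ` {i. i + 1 < n}"
    using x unfolding connecting_vertices_def n_def by fastforce
  \<comment> \<open>There is one connecting vertex fewer than there are cliques; a single clique
    gives the empty list.\<close>
  define xs where "xs = map x [0..<n - 1]"
  have xin: "x i \<in> verts (Bs ! i)" "x i \<in> verts (Bs ! (i + 1))" if "i + 1 < n" for i
    using x[OF that] by blast+
  have Bs_block: "Bs ! m \<in> blocks H" if "m < n" for m
    using that P(3) unfolding n_def by (meson nth_mem subsetD)
  have BsP: "verts (Bs ! m) \<subseteq> verts P" if "m < n" for m
    using that unfolding n_def vP by (meson UN_upper nth_mem)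
  have xP: "x i \<in> verts P" if "i + 1 < n" for i
    using xin(1)[OF that] BsP[of i] that by auto
  have PH: "verts P \<subseteq> verts H" using P(1) by auto
  \<comment> \<open>Any other clique is at distance at least two from clique \<open>i\<close> or
    from clique \<open>i + 1\<close>, both of which contain \<open>x i\<close>.\<close>
  have mem: "m = i \<or> m = i + 1" if "x i \<in> verts (Bs ! m)" "i + 1 < n" "m < n" for i m
  proof (rule ccontr)
    assume "\<not> ?thesis"
    then consider "i + 1 < m" | "m + 1 < i + 1" by linarith
    then show False
      using far[of i m] far[of m "i + 1"] xin[OF that(2)] that by cases auto
  qed
  have xneq: "x i \<noteq> x j" if "i < j" "j + 1 < n" for i j
    using mem[of i "j + 1"] xin(2)[of j] that by auto
  have xadj: "(x i, x (i + 1)) \<in> ?R" if "i + 2 < n" for i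
    using block_graph_adjacent[OF bg Bs_block[of "i + 1"]] xin(2)[of i] xin(1)[of "i + 1"]
      xneq[of i "i + 1"] that by auto
  \<comment> \<open>A block outside \<open>Bs\<close> meets \<open>P\<close> in one vertex only, so
    \<open>K\<close> is a clique of the path, and \<open>mem\<close> applied to both vertices fixes
    its position.\<close>
  have two: "j = i + 1 \<and> K = Bs ! j"
    if K: "K \<in> blocks H" "x i \<in> verts K" "x j \<in> verts K" "i < j" "j + 1 < n" for K i j
  proof (cases "K \<in> set Bs")
    case False
    from off[OF K(1) False] obtain y where "verts K \<inter> verts P = {y}" by blast
    moreover have "x i \<in> verts K \<inter> verts P" "x j \<in> verts K \<inter> verts P" using K xP by auto
    ultimately show ?thesis using xneq[OF K(4,5)] by auto
  next
    case True
    then obtain m where "m < n" "K = Bs ! m" unfolding n_def by (metis in_set_conv_nth)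
    with mem[of i m] mem[of j m] K show ?thesis by auto
  qed
  have path: "successively (\<lambda>a b. (a, b) \<in> ?R) (map x [i..<j])" if "j < n" for i j
    using that
  proof (induction j)
    case (Suc j)
    then show ?case
      using xadj[of "j - 1"] by (cases "i < j") (auto simp: successively_append_iff last_map)
  qed simp
  have dist: "distinct (map x [i..<j])" if "j < n" for i j
    using that xneq by (auto simp: distinct_map inj_on_def) (metis add.commute less_trans_Suc linorder_neqE_nat plus_1_eq_Suc)
  \<comment> \<open>Otherwise take the nearest connecting vertices \<open>x a\<close> and
    \<open>x b\<close> in \<open>S\<close> on either side of \<open>x j\<close>. A path in
    \<open>S\<close> between them and the stretch of the spine avoiding \<open>S\<close> close up to
    a cycle; its block contains both, so \<open>two\<close> forces \<open>b = a + 1\<close>, leaving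
    no room for \<open>j\<close>.\<close>
  have separate: "x j \<in> S"
    if S: "connected_on ?R S" "S \<subseteq> verts H" and ijk: "i < j" "j < k" "k + 1 < n"
      and ends: "x i \<in> S" "x k \<in> S" for S i j k
  proof (rule ccontr)
    assume xj: "x j \<notin> S"
    define a where "a = Max {a. a < j \<and> x a \<in> S}"
    define b where "b = (LEAST b. j < b \<and> x b \<in> S)"
    have "a \<in> {a. a < j \<and> x a \<in> S}" unfolding a_def by (rule Max_in) (use ijk ends in auto)
    then have a: "a < j" "x a \<in> S" by auto
    have a_max: "m \<le> a" if "m < j" "x m \<in> S" for m
      unfolding a_def by (rule Max_ge) (use that in auto)
    have "j < b \<and> x b \<in> S" unfolding b_def by (rule LeastI[of _ k]) (use ijk ends in auto)
    then have b: "j < b" "x b \<in> S" by auto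
    have b_min: "b \<le> m" if "j < m" "x m \<in> S" for m
      unfolding b_def by (rule Least_le) (use that in auto)
    have bn: "b + 1 < n" using b_min[of k] ijk ends by linarith
    have gap: "x m \<notin> S" if "a < m" "m < b" for m
      using a_max[of m] b_min[of m] xj that by (metis linorder_neqE_nat not_le)
    have "(x a, x b) \<in> rtrancl_on S ?R" using S(1) a b unfolding connected_on_def by blast
    from rtrancl_on_distinct_path[OF this]
    obtain p where p: "p \<noteq> []" "hd p = x a" "last p = x b" "distinct p" "set p \<subseteq> S"
      "successively (\<lambda>a b. (a, b) \<in> ?R) p" by blast
    \<comment> \<open>The way back along the spine, strictly between \<open>x b\<close> and
      \<open>x a\<close>; it is non-empty because it contains \<open>x j\<close>.\<close>
    define q where "q = map x (rev [a + 1..<b])"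
    have q: "set q = x ` {a<..<b}" "q \<noteq> []" "last q = x (a + 1)" "hd q = x (b - 1)"
      using a b unfolding q_def by (auto simp: rev_map[symmetric] last_rev hd_rev hd_map last_map)
    have dq: "distinct q" using dist[of b "a + 1"] bn unfolding q_def by (simp add: rev_map[symmetric])
    have "successively (\<lambda>a b. (b, a) \<in> ?R) q"
      using path[of b "a + 1"] bn unfolding q_def by (simp add: rev_map[symmetric])
    then have pq: "successively (\<lambda>a b. (a, b) \<in> ?R) q"
      by (rule successively_mono) (use sym in \<open>auto dest: symD\<close>)
    have "(x b, x (b - 1)) \<in> ?R" using xadj[of "b - 1"] bn b sym by (auto dest: symD)
    moreover have "(x (a + 1), x a) \<in> ?R" using xadj[of a] bn a b sym by (auto dest: symD)
    moreover have "set q \<inter> S = {}" using gap q(1) by auto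
    moreover have "set q \<subseteq> verts H" using q(1) xP PH bn by auto
    ultimately have "distinct (p @ q)" "set (p @ q) \<subseteq> verts H"
      "successively (\<lambda>a b. (a, b) \<in> ?R) (p @ q)" "(last (p @ q), hd (p @ q)) \<in> ?R"
      using p q(2-4) dq pq S(2) by (auto simp: successively_append_iff)
    then obtain K where "K \<in> blocks H" "set (p @ q) \<subseteq> verts K"
      using cycle_in_block[OF H, of "p @ q"] p(1) by blast
    moreover have "x a \<in> set p" "x b \<in> set p" using p(1-3) by (metis hd_in_set last_in_set)+
    ultimately have "b = a + 1" using two[of K a b] a b bn by auto
    with a b show False by simp
  qed
  have simplicial: "simplicial_vertex ?R v" if v: "v \<in> verts H" "v \<notin> connecting_vertices Bs" for v
    unfolding simplicial_vertex_def
  proof (intro allI impI)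
    fix u w assume uvw: "(u, v) \<in> ?R" "(v, w) \<in> ?R" "u \<noteq> w"
    have vH: "u \<in> verts H" "w \<in> verts H" "u \<noteq> v" "v \<noteq> w"
      using arcs_ends_graphD[OF H] uvw by blast+
    from edge_in_block[OF H uvw(1)] obtain K where K: "K \<in> blocks H" "u \<in> verts K" "v \<in> verts K" .
    from edge_in_block[OF H uvw(2)] obtain L where L: "L \<in> blocks H" "v \<in> verts L" "w \<in> verts L" .
    show "(u, w) \<in> ?R"
    proof (cases "v \<in> verts P")
      case True
      \<comment> \<open>A block off the path would meet \<open>P\<close> in a connecting vertex,
        which \<open>v\<close> is not. So all blocks at \<open>v\<close> are cliques of the path,
        and two different ones would make \<open>v\<close> connecting.\<close>
      have inBs: "N \<in> set Bs" if N: "N \<in> blocks H" "v \<in> verts N" for N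
      proof (rule ccontr)
        assume "N \<notin> set Bs"
        from off[OF N(1) this] obtain y where "y \<in> connecting_vertices Bs" "verts N \<inter> verts P = {y}"
          by blast
        with True N(2) v(2) show False by auto
      qed
      have not_next: False if "i < j" "j < n" "v \<in> verts (Bs ! i)" "v \<in> verts (Bs ! j)" for i j
      proof (cases "j = i + 1")
        case True
        with x[of i] that have "v = x i" by auto
        with v(2) conn that True show False by auto
      next
        case False
        with far[of i j] that show False by auto
      qed
      from inBs[OF K(1,3)] obtain i where i: "i < n" "K = Bs ! i" unfolding n_def by (metis in_set_conv_nth)
      from inBs[OF L(1,2)] obtain j where j: "j < n" "L = Bs ! j" unfolding n_def by (metis in_set_conv_nth)
      from i j not_next K(3) L(2) have "i = j" by (metis linorder_neqE_nat)
      with i j K L show ?thesis using block_graph_adjacent[OF bg K(1)] uvw(3) by auto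
    next
      case False
      have anchor: "\<exists>i. i + 1 < n \<and> x i \<in> verts N" if N: "N \<in> blocks H" "v \<in> verts N" for N
      proof -
        have "N \<notin> set Bs" using False N(2) vP by auto
        from off[OF N(1) this] show ?thesis unfolding conn by blast
      qed
      have adj_x: "(x i, v) \<in> ?R" if "N \<in> blocks H" "v \<in> verts N" "x i \<in> verts N" "i + 1 < n" for N i
        using block_graph_adjacent[OF bg that(1,3,2)] xP[OF that(4)] False by auto
      \<comment> \<open>Two attachments would close a cycle through \<open>v\<close> along the
        spine. By \<open>two\<close> its block is a clique of the path, which would put
        \<open>v\<close> on \<open>P\<close>.\<close>
      have same: False if ij: "i < j" "j + 1 < n" and adj: "(x i, v) \<in> ?R" "(x j, v) \<in> ?R" for i j
      proof -
        let ?c = "v # map x [i..<j + 1]"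
        have "set ?c \<subseteq> verts H" using v(1) xP PH ij by auto
        moreover have "distinct ?c" using dist[of "j + 1" i] xP ij False by auto
        moreover have "successively (\<lambda>a b. (a, b) \<in> ?R) ?c"
          using path[of "j + 1" i] ij adj(1) sym
          by (auto simp: successively_Cons hd_map hd_append dest: symD simp del: upt_Suc)
        moreover have "(last ?c, hd ?c) \<in> ?R" using ij adj(2) by (simp add: last_map)
        ultimately obtain N where N: "N \<in> blocks H" "set ?c \<subseteq> verts N"
          using cycle_in_block[OF H, of ?c] by blast
        moreover have "x i \<in> set ?c" "x j \<in> set ?c" using ij by auto
        ultimately have "N = Bs ! j" using two[of N i j] ij by blast
        with N(2) BsP[of j] ij False show False by auto
      qed
      from anchor[OF K(1,3)] obtain i where i: "i + 1 < n" "x i \<in> verts K" by blast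
      from anchor[OF L(1,2)] obtain j where j: "j + 1 < n" "x j \<in> verts L" by blast
      have xv: "(x i, v) \<in> ?R" "(x j, v) \<in> ?R" using adj_x K L i j by blast+
      with same[of i j] same[of j i] i j have ij: "i = j" by (metis linorder_neqE_nat)
      consider "u = x i" | "w = x i" | "u \<noteq> x i" "w \<noteq> x i" by blast
      then show ?thesis
      proof cases
        case 1
        then show ?thesis using block_graph_adjacent[OF bg L(1)] L j ij uvw(3) by auto
      next
        case 2
        then show ?thesis using block_graph_adjacent[OF bg K(1)] K i uvw(3) by auto
      next
        \<comment> \<open>Both blocks at \<open>v\<close> hang on the same connecting vertex, so
          \<open>u\<close>, \<open>v\<close>, \<open>w\<close>, \<open>x i\<close> is a 4-cycle and
          lies in a single clique.\<close>
        case 3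
        have "v \<noteq> x i" using xP[OF i(1)] False by auto
        moreover have "(w, x i) \<in> ?R"
          using block_graph_adjacent[OF bg L(1)] L j ij 3 by auto
        moreover have "(x i, u) \<in> ?R"
          using block_graph_adjacent[OF bg K(1)] K i 3 by auto
        moreover have "x i \<in> verts H" using xP[OF i(1)] PH by auto
        ultimately obtain N where N: "N \<in> blocks H" "set [u, v, w, x i] \<subseteq> verts N"
          using cycle_in_block[OF H, of "[u, v, w, x i]"] uvw v(1) vH 3 by auto
        then show ?thesis using block_graph_adjacent[OF bg N(1)] uvw(3) by auto
      qed
    qed
  qed
  have "set xs = connecting_vertices Bs" unfolding xs_def conn by auto
  then show thesis
  proof (intro that[of xs])
    fix S i j k
    assume "connected_on ?R S" "S \<subseteq> verts H" "i < j" "j < k" "k < length xs" "xs ! i \<in> S" "xs ! k \<in> S"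
    then show "xs ! j \<in> S" using separate[of S i j k] unfolding xs_def by simp
  qed (use simplicial in auto)
qed

section \<open>\<open>r\<close>-independence complexes\<close>

definition connected_sets :: "('a,'b) pre_digraph \<Rightarrow> nat \<Rightarrow> 'a set set" where
  "connected_sets G k = {e. e \<subseteq> verts G \<and> connected_on (arcs_ends G) e \<and> card e = k}"

text \<open>A connected set of \<open>r + 1\<close> vertices inside \<open>A\<close> lies in one
  component of the induced subgraph; conversely a component with more than \<open>r\<close> vertices
  contains a connected set of exactly \<open>r + 1\<close>.\<close>

lemma r_independent_iff:
  assumes G: "graph G"
  shows "r_independent G r A \<longleftrightarrow> A \<subseteq> verts G \<and> independent_in (connected_sets G (r + 1)) A"
proof (cases "A \<subseteq> verts G")
  case True
  interpret graph G by fact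
  let ?H = "G \<restriction> A"
  have ind: "induced_subgraph ?H G" using True by (rule induced_induce)
  interpret H: graph ?H by (rule graph_induced_subgraph[OF G ind])
  have "(\<forall>C\<in>pre_digraph.sccs ?H. card (verts C) \<le> r) \<longleftrightarrow> independent_in (connected_sets G (r + 1)) A"
  proof
    assume small: "\<forall>C\<in>pre_digraph.sccs ?H. card (verts C) \<le> r"
    show "independent_in (connected_sets G (r + 1)) A"
      unfolding independent_in_def
    proof (intro ballI notI)
      fix e assume e: "e \<in> connected_sets G (r + 1)" "e \<subseteq> A"
      then have conn: "connected_on (arcs_ends ?H) e" and ce: "card e = r + 1"
        by (auto simp: connected_sets_def connected_on_induce)
      then obtain a where a: "a \<in> e" unfolding connected_on_def by blast
      let ?C = "?H \<restriction> {v. a \<rightarrow>\<^sup>*\<^bsub>?H\<^esub> v}"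
      have "?C \<in> pre_digraph.sccs ?H"
        by (rule H.induce_reachable_is_in_sccs) (use a e in auto)
      with small have "card {v. a \<rightarrow>\<^sup>*\<^bsub>?H\<^esub> v} \<le> r" by fastforce
      moreover have "e \<subseteq> {v. a \<rightarrow>\<^sup>*\<^bsub>?H\<^esub> v}"
        using conn a rtrancl_on_mono[OF order_refl e(2)] unfolding connected_on_def reachable_def
        by auto
      moreover have "finite {v. a \<rightarrow>\<^sup>*\<^bsub>?H\<^esub> v}"
        by (rule finite_subset[OF _ H.finite_verts]) (auto dest: H.reachable_in_verts)
      ultimately have "card e \<le> r" using card_mono le_trans by blast
      with ce show False by simp
    qed
  next
    assume indep: "independent_in (connected_sets G (r + 1)) A"
    show "\<forall>C\<in>pre_digraph.sccs ?H. card (verts C) \<le> r"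
    proof (rule ballI, rule ccontr)
      fix C assume C: "C \<in> pre_digraph.sccs ?H" "\<not> card (verts C) \<le> r"
      then have CH: "induced_subgraph C ?H" "strongly_connected C" by (auto simp: pre_digraph.sccs_def)
      then have "verts C \<subseteq> A" using subgraph_imp_subverts[OF induced_imp_subgraph] by fastforce
      moreover have "connected_on (arcs_ends G) (verts C)"
        using CH H.induce_eq_iff_induced[OF CH(1)] \<open>verts C \<subseteq> A\<close>
          strongly_connected_induce_iff[of ?H "verts C"] connected_on_induce by metis
      moreover have "finite (verts C)"
        using \<open>verts C \<subseteq> A\<close> True finite_verts by (meson finite_subset)
      ultimately obtain T where T: "T \<subseteq> verts C" "connected_on (arcs_ends G) T" "card T = r + 1"
        using connected_on_subset_card[OF sym_arcs_ends[OF G], of "verts C" "r + 1"] C(2) by auto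
      with \<open>verts C \<subseteq> A\<close> True have "T \<in> connected_sets G (r + 1)" "T \<subseteq> A"
        unfolding connected_sets_def by auto
      with indep show False unfolding independent_in_def by blast
    qed
  qed
  with True show ?thesis unfolding r_independent_def by simp
qed (simp add: r_independent_def)

text \<open>Unless \<open>e2 \<subseteq> e1\<close>, the union has more than \<open>k\<close>
  vertices; it stays connected without \<open>v\<close> and can be trimmed to a connected set of
  size \<open>k\<close>.\<close>

lemma simplicial_for_connected_sets:
  assumes G: "graph G" and v: "simplicial_vertex (arcs_ends G) v" and k: "k \<ge> 1"
  shows "simplicial_for (connected_sets G k) Q v"
  unfolding simplicial_for_def
proof (intro ballI impI)
  interpret graph G by fact
  fix e1 e2 assume e: "e1 \<in> connected_sets G k" "e2 \<in> connected_sets G k" "v \<in> e1" "v \<in> e2"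
  show "e1 - Q \<subseteq> e2 \<or> e2 - Q \<subseteq> e1 \<or> (\<exists>e3\<in>connected_sets G k. e3 \<subseteq> e1 \<union> e2 - {v})"
  proof (cases "e2 \<subseteq> e1")
    case False
    let ?U = "e1 \<union> e2"
    from e have e': "?U \<subseteq> verts G" "connected_on (arcs_ends G) e1" "connected_on (arcs_ends G) e2"
      "card e1 = k" unfolding connected_sets_def by auto
    have fin: "finite ?U" using e'(1) finite_verts by (rule finite_subset)
    have "card e1 < card ?U" using False fin by (intro psubset_card_mono) auto
    then have card: "k \<le> card (?U - {v})" using e'(4) e(3) fin by simp
    with k have "card (?U - {v}) \<noteq> 0" by linarith
    then have "?U - {v} \<noteq> {}" by (metis card.empty)
    moreover have "connected_on (arcs_ends G) ?U"
      using connected_on_Un[OF e'(2,3)] e(3,4) by blast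
    ultimately have "connected_on (arcs_ends G) (?U - {v})"
      using connected_on_remove_simplicial[OF sym_arcs_ends[OF G] _ v] by blast
    from connected_on_subset_card[OF sym_arcs_ends[OF G] this _ k card] fin
    obtain T where "T \<subseteq> ?U - {v}" "connected_on (arcs_ends G) T" "card T = k" by auto
    with e'(1) have "T \<in> connected_sets G k" "T \<subseteq> ?U - {v}" unfolding connected_sets_def by auto
    then show ?thesis by blast
  qed blast
qed

text \<open>If no vertex outside \<open>Q\<close> is simplicial in \<open>G\<close>, take a
  component not contained in \<open>Q\<close>. Its vertices outside \<open>Q\<close> all lie on the
  spine, and the leftmost of them works.\<close>

lemma T1_graph_simplicial_for:
  assumes T1: "T1_graph G" and k: "k \<ge> 1" and Q: "Q \<subset> verts G"
  shows "\<exists>v\<in>verts G - Q. simplicial_for (connected_sets G k) Q v"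
proof (cases "\<exists>v\<in>verts G - Q. simplicial_vertex (arcs_ends G) v")
  case True
  then obtain v where v: "v \<in> verts G - Q" "simplicial_vertex (arcs_ends G) v" ..
  have "graph G" using T1 unfolding T1_graph_def by simp
  from simplicial_for_connected_sets[OF this v(2) k] v(1) show ?thesis ..
next
  case False
  from T1 have G: "graph G" unfolding T1_graph_def by simp
  interpret graph G by fact
  from Q obtain u where u: "u \<in> verts G" "u \<notin> Q" by blast
  define W where "W = {v. u \<rightarrow>\<^sup>*\<^bsub>G\<^esub> v}"
  let ?C = "G \<restriction> W"
  have scc: "?C \<in> sccs" unfolding W_def by (rule induce_reachable_is_in_sccs[OF u(1)])
  then have graph_C: "graph ?C" using graph_induced_subgraph[OF G] in_sccs_imp_induced by blast
  have T1_C: "connected_T1_graph ?C" using T1 scc unfolding T1_graph_def by blast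
  have uW: "u \<in> W" using u(1) unfolding W_def by simp
  have WV: "W \<subseteq> verts G" unfolding W_def by (auto dest: reachable_in_verts)
  have closed: "w \<in> W" if "v \<in> W" "(v, w) \<in> arcs_ends G" for v w
    using that unfolding W_def by (auto intro: reachable_adj_trans)
  obtain xs where simplicial: "\<And>v. v \<in> W \<Longrightarrow> v \<notin> set xs \<Longrightarrow> simplicial_vertex (arcs_ends ?C) v"
    and between: "\<And>S i j k. \<lbrakk>connected_on (arcs_ends ?C) S; S \<subseteq> W; i < j; j < k; k < length xs;
           xs ! i \<in> S; xs ! k \<in> S\<rbrakk> \<Longrightarrow> xs ! j \<in> S"
    using connected_T1_graph_spine[OF graph_C T1_C] unfolding induce_subgraph_verts by blast
  \<comment> \<open>All neighbours of \<open>v\<close> in \<open>G\<close> lie in its component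
    \<open>W\<close>, so a vertex simplicial in \<open>?C\<close> would be simplicial in
    \<open>G\<close>.\<close>
  have on_spine: "v \<in> set xs" if "v \<in> W - Q" for v
  proof (rule ccontr)
    assume "v \<notin> set xs"
    with simplicial that have "simplicial_vertex (arcs_ends ?C) v" by blast
    moreover have "u \<in> W" if "(u, v) \<in> arcs_ends G" for u
      using closed[of v u] symD[OF sym_arcs_ends[OF G] that] \<open>v \<in> W - Q\<close> by blast
    ultimately have "simplicial_vertex (arcs_ends G) v"
      using closed[of v] that unfolding simplicial_vertex_def arcs_ends_induce by blast
    with False that WV show False by blast
  qed
  define i where "i = (LEAST i. i < length xs \<and> xs ! i \<in> W - Q)"
  have "\<exists>i. i < length xs \<and> xs ! i \<in> W - Q"
    using on_spine[of u] uW u(2) by (metis DiffI in_set_conv_nth)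
  then have i: "i < length xs" "xs ! i \<in> W - Q"
    using LeastI_ex[of "\<lambda>i. i < length xs \<and> xs ! i \<in> W - Q"] unfolding i_def by blast+
  have i_min: "i \<le> a" if "a < length xs" "xs ! a \<in> W - Q" for a
    unfolding i_def by (rule Least_le) (use that in blast)
  have edge: "e \<subseteq> W" "connected_on (arcs_ends ?C) e" if "e \<in> connected_sets G k" "xs ! i \<in> e" for e
  proof -
    have conn: "connected_on (arcs_ends G) e" using that(1) unfolding connected_sets_def by simp
    show "e \<subseteq> W"
    proof
      fix b assume "b \<in> e"
      with conn that(2) have "(xs ! i, b) \<in> rtrancl_on e (arcs_ends G)" unfolding connected_on_def by blast
      then show "b \<in> W" by (induction rule: rtrancl_on_induct) (use i closed in auto)
    qed
    with conn show "connected_on (arcs_ends ?C) e" by (simp add: connected_on_induce)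
  qed
  have "simplicial_for (connected_sets G k) Q (xs ! i)"
    unfolding simplicial_for_def
  proof (intro ballI impI)
    fix e1 e2
    assume e: "e1 \<in> connected_sets G k" "e2 \<in> connected_sets G k" "xs ! i \<in> e1" "xs ! i \<in> e2"
    \<comment> \<open>Both edges contain \<open>xs ! i\<close>, and outside \<open>Q\<close> nothing
      lies to its left. A spine vertex \<open>z\<close> missing from \<open>e2\<close> is therefore
      to the right of every \<open>w\<close> in \<open>e2 - Q\<close>, and such a \<open>w\<close>
      lies between \<open>xs ! i\<close> and \<open>z\<close>, or equals \<open>xs ! i\<close>,
      hence in \<open>e1\<close>.\<close>
    have "e2 - Q \<subseteq> e1" if nsub: "\<not> e1 - Q \<subseteq> e2"
    proof
      fix w assume w: "w \<in> e2 - Q"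
      from nsub obtain z where z: "z \<in> e1 - Q" "z \<notin> e2" by blast
      from z edge[OF e(1,3)] on_spine obtain a where a: "a < length xs" "z = xs ! a" 
        by (metis DiffD1 DiffD2 DiffI in_set_conv_nth subsetD)
      from w edge[OF e(2,4)] on_spine obtain b where b: "b < length xs" "w = xs ! b"
        by (metis DiffD1 DiffD2 DiffI in_set_conv_nth subsetD)
      have "i \<le> a" using i_min[OF a(1)] a z edge[OF e(1,3)] by blast
      moreover have "i \<le> b" using i_min[OF b(1)] b w edge[OF e(2,4)] by blast
      moreover have "\<not> a < b"
      proof
        assume "a < b"
        moreover have "i \<noteq> a" using z a e(4) by auto
        ultimately have "xs ! a \<in> e2"
          using between[OF edge(2)[OF e(2,4)] edge(1)[OF e(2,4)], of i a b] \<open>i \<le> a\<close> b w e(4) by auto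
        with z a show False by simp
      qed
      moreover have "a \<noteq> b" using a b z w by auto
      ultimately have "b = i \<or> i < b \<and> b < a" by linarith
      then show "w \<in> e1"
        using between[OF edge(2)[OF e(1,3)] edge(1)[OF e(1,3)], of i b a] a b z e(3) by auto
    qed
    then show "e1 - Q \<subseteq> e2 \<or> e2 - Q \<subseteq> e1 \<or> (\<exists>e3\<in>connected_sets G k. e3 \<subseteq> e1 \<union> e2 - {xs ! i})"
      by blast
  qed
  with i(2) WV show ?thesis by blast
qed

theorem theorem4p16:
  fixes G :: "('a,'b) pre_digraph" and r :: nat
  assumes "T1_graph G" and "r \<ge> 5"
  shows "shellable (Ind r G)"
proof -
  have G: "graph G" using assms(1) unfolding T1_graph_def by simp
  interpret graph G by fact
  have "shellable {A. A \<subseteq> verts G \<and> independent_in (connected_sets G (r + 1)) A}"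
  proof (rule shellable_independence_complex)
    fix Q assume "Q \<subset> verts G"
    then show "\<exists>v\<in>verts G - Q. simplicial_for (connected_sets G (r + 1)) Q v"
      by (intro T1_graph_simplicial_for assms(1)) simp_all
  qed (auto simp: connected_sets_def)
  then show ?thesis unfolding Ind_def r_independent_iff[OF G] .
qed

end
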